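(* Let $\Delta\neq 1$ be a fundamental discriminant and let $X>0$. Let $\mathcal{C}(X)$ be the class of functions $g:[0,\infty)\to\mathbb{R}$ that are continuous, supported on $[0,X]$, satisfy $g(0)=1$, and have non-negative cosine transform $h(t)=2\int_0^\infty g(x)\cos(tx)\,dx$ (for all real $t$). For $g\in\mathcal{C}(X)$ define $$l(g)=2\sum_{n=1}^{\infty}\frac{\Lambda(n)\chi_\Delta(n)}{\sqrt{n}}g(\log n)+\log(8\pi e^\gamma)-\int_0^\infty\frac{1-g(x)}{2\sinh(x/2)}\,dx+\chi_\Delta(-1)\int_0^\infty\frac{g(x)}{2\cosh(x/2)}\,dx,$$ where $l(g)$ is interpreted as $-\infty$ if the integral $\int_0^\infty\frac{1-g(x)}{2\sinh(x/2)}\,dx$ diverges. Then there exists $g_X\in\mathcal{C}(X)$ such that $l(g_X)\ge l(g)$ for all $g\in\mathcal{C}(X)$.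
   Context: A fundamental discriminant is $1$ or the discriminant of a quadratic number field. For a fundamental discriminant $\Delta$, $\chi_\Delta(n)=\left(\frac{\Delta}{n}\right)$ is the Kronecker symbol. $\Lambda$ is the von Mangoldt function and $\gamma$ is Euler's constant. (For $g\in\mathcal{C}(X)$ the integrand $\frac{1-g(x)}{2\sinh(x/2)}$ is non-negative, so the integral is either finite or $+\infty$.) *)

theory Defs
  imports "HOL-Analysis.Analysis" "HOL-Number_Theory.Number_Theory"
    "HOL-Computational_Algebra.Squarefree"
begin

text \<open>Fundamental discriminants: 1 or the discriminant of a quadratic field.\<close>
definition fundamental_discriminant :: "int \<Rightarrow> bool" where
  "fundamental_discriminant D \<longleftrightarrow>
     (D mod 4 = 1 \<and> squarefree D) \<or>
     (\<exists>m. D = 4 * m \<and> (m mod 4 = 2 \<or> m mod 4 = 3) \<and> squarefree m)"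

definition kronecker_prime :: "int \<Rightarrow> int \<Rightarrow> int" where
  "kronecker_prime D p =
     (if p = 2 then (if even D then 0 else if D mod 8 = 1 \<or> D mod 8 = 7 then 1 else -1)
      else Legendre D p)"

definition kronecker :: "int \<Rightarrow> int \<Rightarrow> int" where
  "kronecker D n =
     (if n = 0 then (if \<bar>D\<bar> = 1 then 1 else 0)
      else (if n < 0 \<and> D < 0 then -1 else 1) *
        (\<Prod>p\<in>prime_factors (nat \<bar>n\<bar>). kronecker_prime D (int p) ^ multiplicity p (nat \<bar>n\<bar>)))"

definition classC :: "real \<Rightarrow> (real \<Rightarrow> real) set" where
  "classC X = {g. continuous_on {0..} g \<and> (\<forall>x. x > X \<longrightarrow> g x = 0) \<and> g 0 = 1 \<and>
      (\<forall>t::real. 2 * (LINT x:{0..}|lborel. g x * cos (t * x)) \<ge> 0)}"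

definition lfun :: "int \<Rightarrow> (real \<Rightarrow> real) \<Rightarrow> ereal" where
  "lfun D g =
     ereal (2 * (\<Sum>n. mangoldt n * real_of_int (kronecker D (int n)) / sqrt (real n) * g (ln (real n)))
            + ln (8 * pi * exp euler_mascheroni)
            + real_of_int (kronecker D (-1)) * (LINT x:{0..}|lborel. g x / (2 * cosh (x / 2))))
     - enn2ereal (\<integral>\<^sup>+ x. ennreal (indicator {0<..} x * ((1 - g x) / (2 * sinh (x / 2)))) \<partial>lborel)"

end

theory Submission
  imports Defs "HOL-Probability.Characteristic_Functions" "HOL-Complex_Analysis.Great_Picard"
begin

text \<open>
  Write \<open>l(g) = R(g) - J(g)\<close> with \<open>J(g)\<close> the sinh integral. The remaining part \<open>R\<close> is bounded above
  on the class and continuous under pointwise convergence, since only the terms \<open>n \<le> exp X\<close> contribute;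
  \<open>J\<close> is lower semicontinuous by Fatou's lemma. Hence it suffices to find a convergent subsequence
  of a maximising sequence, along which \<open>J\<close> is bounded. Averaging the cosine transform against
  Gaussians shows that \<open>g\<close> is positive definite: every inequality \<open>\<Sum> c\<^sub>i cos (t x\<^sub>i) \<ge> 0\<close> valid for
  all \<open>t\<close> implies \<open>\<Sum> c\<^sub>i g \<bar>x\<^sub>i\<bar> \<ge> 0\<close>. So \<open>\<bar>g\<bar> \<le> 1\<close>, the modulus of continuity of \<open>g\<close> is controlled
  by \<open>1 - g\<close> near \<open>0\<close>, and a bound on \<open>J(g)\<close> forces \<open>1 - g(d) = O(1 / log (1/d))\<close> uniformly.
  The sublevel sets of \<open>J\<close> are therefore equicontinuous and Arzela--Ascoli applies.
\<close>

section \<open>Gaussian averaging and positive definiteness\<close>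

text \<open>This is the real part of the characteristic function of the standard normal law.\<close>

lemma integral_cos_std_normal:
  "(LINT t|std_normal_distribution. cos (t * a)) = exp (- (a\<^sup>2) / 2)"
proof -
  interpret real_distribution std_normal_distribution by (rule real_dist_normal_dist)
  have "Re (char std_normal_distribution a) = (LINT t|std_normal_distribution. Re (iexp (a * t)))"
    unfolding char_def by (subst integral_Re) (auto intro!: integrable_iexp)
  then show ?thesis
    by (simp add: char_std_normal_distribution mult.commute del: Re_exp cong: Bochner_Integration.integral_cong)
      (simp add: Re_exp mult.commute)
qed

lemma integrable_continuous_compact_support:
  fixes F :: "real \<Rightarrow> real"
  assumes "continuous_on UNIV F" "\<And>y. X < \<bar>y\<bar> \<Longrightarrow> F y = 0"
  shows "integrable lborel F"
proof -
  have "set_integrable lborel {-X..X} F"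
    by (intro borel_integrable_atLeastAtMost' continuous_on_subset[OF assms(1)]) auto
  moreover have "(\<lambda>y. indicat_real {-X..X} y *\<^sub>R F y) = F"
    using assms(2) by (force simp: fun_eq_iff indicator_def abs_le_iff not_less[symmetric])
  ultimately show ?thesis by (simp add: set_integrable_def)
qed

text \<open>Evenness of \<open>G\<close> kills its sine integrals, so multiplying the cosine
  transform by \<open>cos (t * s * x)\<close> merely translates the kernel to
  \<open>cos (t * s * (y - x))\<close>. Fubini then lets the normal law be integrated first, which
  yields a Gaussian centred at \<open>x\<close>.\<close>

lemma gaussian_average_cosine_transform:
  fixes G :: "real \<Rightarrow> real"
  assumes cont: "continuous_on UNIV G" and supp: "\<And>y. X < \<bar>y\<bar> \<Longrightarrow> G y = 0"
    and even: "\<And>y. G (- y) = G y"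
  shows "(LINT t|std_normal_distribution. (LINT y|lborel. G y * cos (t * s * y)) * cos (t * s * x))
           = (LINT y|lborel. G y * exp (- ((s * (y - x))\<^sup>2) / 2))"
proof -
  interpret N: real_distribution std_normal_distribution by (rule real_dist_normal_dist)
  interpret P: pair_sigma_finite std_normal_distribution "lborel :: real measure" ..
  have [measurable]: "G \<in> borel_measurable borel"
    using cont by (rule borel_measurable_continuous_onI)
  have int: "integrable lborel G"
    using cont supp by (rule integrable_continuous_compact_support)
  have intb: "integrable lborel (\<lambda>y. G y * b y)"
    if "b \<in> borel_measurable borel" "\<And>y. \<bar>b y\<bar> \<le> 1" for b :: "real \<Rightarrow> real"
    using int that by (intro Bochner_Integration.integrable_bound[OF int])
      (auto simp: abs_mult intro!: mult_left_le)
  have sin0: "(LINT y|lborel. G y * sin (r * y)) = 0" for r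
  proof -
    have "(LINT y|lborel. G y * sin (r * y)) = (LINT y|lborel. G (- y) * sin (r * (- y)))"
      using lborel_integral_real_affine[of "-1" "\<lambda>y. G y * sin (r * y)" 0] by simp
    then show ?thesis by (simp add: even)
  qed
  have shift: "(LINT y|lborel. G y * cos (r * y)) * cos (r * x) = (LINT y|lborel. G y * cos (r * (y - x)))" for r
  proof -
    have "(LINT y|lborel. G y * cos (r * (y - x)))
       = (LINT y|lborel. (G y * cos (r * y)) * cos (r * x) + (G y * sin (r * y)) * sin (r * x))"
      by (intro Bochner_Integration.integral_cong) (auto simp: right_diff_distrib cos_diff algebra_simps)
    also have "\<dots> = (LINT y|lborel. G y * cos (r * y)) * cos (r * x) + (LINT y|lborel. G y * sin (r * y)) * sin (r * x)"
      by (subst Bochner_Integration.integral_add) (auto intro!: intb integrable_mult_left)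
    finally show ?thesis by (simp add: sin0)
  qed
  have "integrable (std_normal_distribution \<Otimes>\<^sub>M lborel) (\<lambda>(t, y). G y)"
    by (rule P.Fubini_integrable) (use int in auto)
  then have prod: "integrable (std_normal_distribution \<Otimes>\<^sub>M lborel) (\<lambda>(t, y). G y * cos (t * (s * (y - x))))"
    by (rule Bochner_Integration.integrable_bound) (auto simp: split_beta abs_mult intro!: AE_I2 mult_left_le)
  have "(LINT t|std_normal_distribution. (LINT y|lborel. G y * cos (t * s * y)) * cos (t * s * x))
     = (LINT t|std_normal_distribution. (LINT y|lborel. G y * cos (t * (s * (y - x)))))"
    by (simp add: shift mult.assoc[symmetric])
  also have "\<dots> = (LINT y|lborel. (LINT t|std_normal_distribution. G y * cos (t * (s * (y - x)))))"
    using prod by (rule P.Fubini_integral[symmetric])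
  finally show ?thesis by (simp add: integral_cos_std_normal)
qed

text \<open>Substituting \<open>y = x + u / Suc n\<close> moves the scaling from the Gaussian into
  \<open>G\<close>, and dominated convergence applies because \<open>G\<close> is bounded. The
  factor \<open>sqrt (2 * pi)\<close> is the mass of the unnormalised Gaussian.\<close>

lemma gaussian_approximate_identity:
  fixes G :: "real \<Rightarrow> real"
  assumes cont: "continuous_on UNIV G" and supp: "\<And>y. X < \<bar>y\<bar> \<Longrightarrow> G y = 0"
  shows "(\<lambda>n. real (Suc n) * (LINT y|lborel. G y * exp (- ((real (Suc n) * (y - x))\<^sup>2) / 2)))
           \<longlonglongrightarrow> G x * sqrt (2 * pi)"
proof -
  have [measurable]: "G \<in> borel_measurable borel"
    using cont by (rule borel_measurable_continuous_onI)
  obtain B where B: "\<And>y. \<bar>G y\<bar> \<le> B"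
  proof -
    have "compact (G ` {-X..X})"
      by (intro compact_continuous_image continuous_on_subset[OF cont]) auto
    then obtain B where "\<forall>z\<in>G ` {-X..X}. norm z \<le> B"
      using compact_imp_bounded bounded_iff by metis
    then have "\<bar>G y\<bar> \<le> max B 0" for y
      using supp[of y] by (cases "\<bar>y\<bar> \<le> X") (auto simp: abs_le_iff le_max_iff_disj)
    then show ?thesis by (rule that)
  qed
  define E :: "real \<Rightarrow> real" where "E u = exp (- (u\<^sup>2) / 2)" for u
  have [measurable]: "E \<in> borel_measurable borel" unfolding E_def by measurable
  have hE: "has_bochner_integral lborel E (sqrt (2 * pi))"
  proof -
    have "has_bochner_integral lborel (\<lambda>u. sqrt (2 * pi) * std_normal_density u) (sqrt (2 * pi) * 1)"
      by (intro has_bochner_integral_mult_right)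
        (simp add: has_bochner_integral_iff integrable_std_normal_moment[of 0, simplified] integral_std_normal_moment_even[of 0, simplified])
    moreover have "(\<lambda>u. sqrt (2 * pi) * std_normal_density u) = E"
      by (auto simp: fun_eq_iff E_def std_normal_density_def)
    ultimately show ?thesis by simp
  qed
  have subst: "real (Suc n) * (LINT y|lborel. G y * E (real (Suc n) * (y - x)))
      = (LINT u|lborel. G (x + u / real (Suc n)) * E u)" for n
    by (subst lborel_integral_real_affine[of "1 / real (Suc n)" _ x]) (simp_all del: of_nat_Suc)
  have "(\<lambda>n. (LINT u|lborel. G (x + u / real (Suc n)) * E u)) \<longlonglongrightarrow> (LINT u|lborel. G x * E u)"
  proof (rule integral_dominated_convergence)
    show "integrable lborel (\<lambda>u. B * E u)"
      using hE by (auto simp: has_bochner_integral_iff)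
    show "AE u in lborel. (\<lambda>n. G (x + u / real (Suc n)) * E u) \<longlonglongrightarrow> G x * E u"
    proof (rule AE_I2)
      fix u :: real
      have "(\<lambda>n. x + u * inverse (real (Suc n))) \<longlonglongrightarrow> x + u * 0"
        by (intro tendsto_intros LIMSEQ_inverse_real_of_nat)
      then have "(\<lambda>n. x + u / real (Suc n)) \<longlonglongrightarrow> x"
        by (simp add: divide_inverse)
      then have "(\<lambda>n. G (x + u / real (Suc n))) \<longlonglongrightarrow> G x"
        using continuous_on_tendsto_compose[OF cont] by auto
      then show "(\<lambda>n. G (x + u / real (Suc n)) * E u) \<longlonglongrightarrow> G x * E u"
        by (intro tendsto_intros)
    qed
    show "AE u in lborel. norm (G (x + u / real (Suc n)) * E u) \<le> B * E u" for n
      using B by (auto simp: abs_mult E_def)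
  qed auto
  moreover have "(LINT u|lborel. G x * E u) = G x * sqrt (2 * pi)"
    using hE by (simp add: has_bochner_integral_iff)
  ultimately show ?thesis
    unfolding subst[symmetric] by (simp only: E_def)
qed

text \<open>The product of the two nonnegative functions of \<open>t\<close> has nonnegative
  Gaussian average, and that average is a smoothed version of the sum in the conclusion. Letting the
  scale \<open>s\<close> tend to infinity removes the smoothing. The Gaussian weight makes the
  frequency integral converge although the transform is only known to be bounded.\<close>

lemma cosine_polynomial_nonneg_imp:
  fixes G :: "real \<Rightarrow> real" and c x :: "'i \<Rightarrow> real"
  assumes cont: "continuous_on UNIV G" and supp: "\<And>y. X < \<bar>y\<bar> \<Longrightarrow> G y = 0"
    and even: "\<And>y. G (- y) = G y"
    and pos: "\<And>t. 0 \<le> (LINT y|lborel. G y * cos (t * y))"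
    and poly: "\<And>t. 0 \<le> (\<Sum>i\<in>I. c i * cos (t * x i))"
  shows "0 \<le> (\<Sum>i\<in>I. c i * G (x i))"
proof -
  interpret N: real_distribution std_normal_distribution by (rule real_dist_normal_dist)
  have [measurable]: "G \<in> borel_measurable borel"
    using cont by (rule borel_measurable_continuous_onI)
  have int: "integrable lborel G"
    using cont supp by (rule integrable_continuous_compact_support)
  define H where "H t = (LINT y|lborel. G y * cos (t * y))" for t
  have [measurable]: "H \<in> borel_measurable borel"
    unfolding H_def by measurable
  have H: "\<bar>H t\<bar> \<le> (LINT y|lborel. \<bar>G y\<bar>)" for t
  proof -
    have "norm (H t) \<le> (LINT y|lborel. norm (G y * cos (t * y)))"
      unfolding H_def by (rule integral_norm_bound)
    also have "\<dots> \<le> (LINT y|lborel. \<bar>G y\<bar>)"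
      using int by (intro integral_mono Bochner_Integration.integrable_bound[OF int])
         (auto simp: abs_mult intro!: mult_left_le)
    finally show ?thesis by simp
  qed
  have gauss: "0 \<le> (\<Sum>i\<in>I. c i * (LINT y|lborel. G y * exp (- ((s * (y - x i))\<^sup>2) / 2)))" for s
  proof -
    have 1: "integrable std_normal_distribution (\<lambda>t. c i * (H (t * s) * cos (t * s * x i)))" for i
      by (intro integrable_mult_right N.integrable_const_bound[where B = "LINT y|lborel. \<bar>G y\<bar>"])
        (auto simp: abs_mult intro!: order_trans[OF mult_left_le H])
    have "0 \<le> (LINT t|std_normal_distribution. H (t * s) * (\<Sum>i\<in>I. c i * cos (t * s * x i)))"
      by (intro Bochner_Integration.integral_nonneg mult_nonneg_nonneg) (auto simp: H_def pos poly)
    also have "\<dots> = (LINT t|std_normal_distribution. (\<Sum>i\<in>I. c i * (H (t * s) * cos (t * s * x i))))"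
      by (simp add: sum_distrib_left mult_ac)
    also have "\<dots> = (\<Sum>i\<in>I. c i * (LINT t|std_normal_distribution. H (t * s) * cos (t * s * x i)))"
      using 1 by (subst Bochner_Integration.integral_sum) auto
    finally show ?thesis
      unfolding H_def by (simp only: gaussian_average_cosine_transform[OF cont supp even])
  qed
  have nonneg: "0 \<le> (\<Sum>i\<in>I. c i * (real (Suc n) *
      (LINT y|lborel. G y * exp (- ((real (Suc n) * (y - x i))\<^sup>2) / 2))))" for n
    using mult_nonneg_nonneg[OF of_nat_0_le_iff[of "Suc n"] gauss[of "real (Suc n)"]]
    by (simp only: sum_distrib_left mult.left_commute[of "real (Suc n)"])
  have "(\<lambda>n. \<Sum>i\<in>I. c i * (real (Suc n) *
      (LINT y|lborel. G y * exp (- ((real (Suc n) * (y - x i))\<^sup>2) / 2))))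
        \<longlonglongrightarrow> (\<Sum>i\<in>I. c i * (G (x i) * sqrt (2 * pi)))"
    by (intro tendsto_intros gaussian_approximate_identity[OF cont supp])
  then have "0 \<le> (\<Sum>i\<in>I. c i * (G (x i) * sqrt (2 * pi)))"
    by (rule LIMSEQ_le_const) (use nonneg in auto)
  also have "\<dots> = (\<Sum>i\<in>I. c i * G (x i)) * sqrt (2 * pi)"
    by (simp add: sum_distrib_right mult.assoc)
  finally show ?thesis using pi_gt_zero by (simp add: zero_le_mult_iff)
qed

section \<open>Inequalities for class members obtained from inequalities between cosines\<close>

lemma classC_continuous_even_extension:
  assumes "g \<in> classC X"
  shows "continuous_on UNIV (\<lambda>y. g \<bar>y\<bar>)"
proof -
  have "continuous_on {0..} g" using assms by (simp add: classC_def)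
  then show ?thesis
    by (rule continuous_on_compose2[where f = abs]) (auto intro: continuous_on_rabs continuous_on_id)
qed

text \<open>The even extension of \<open>g\<close> has as its transform over the whole line exactly
  the half-line expression in \<open>classC\<close>. Below, linear inequalities for \<open>g\<close>
  are derived by listing weights and nodes; the node 0 carries the constant term, since
  \<open>g 0 = 1\<close>.\<close>

lemma classC_cosine_polynomial:
  fixes c x :: "'i \<Rightarrow> real"
  assumes g: "g \<in> classC X" and poly: "\<And>t. 0 \<le> (\<Sum>i\<in>I. c i * cos (t * x i))"
  shows "0 \<le> (\<Sum>i\<in>I. c i * g \<bar>x i\<bar>)"
proof (rule cosine_polynomial_nonneg_imp[OF classC_continuous_even_extension[OF g] _ _ _ poly, where X = X])
  show supp: "g \<bar>y\<bar> = 0" if "X < \<bar>y\<bar>" for y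
    using g that by (auto simp: classC_def)
  show "0 \<le> (LINT y|lborel. g \<bar>y\<bar> * cos (t * y))" for t
  proof -
    have int: "integrable lborel (\<lambda>y. g \<bar>y\<bar> * cos (t * y))"
      by (rule integrable_continuous_compact_support[where X = X])
        (auto simp: supp intro!: continuous_intros classC_continuous_even_extension[OF g])
    have "has_bochner_integral lborel (\<lambda>y. g \<bar>y\<bar> * cos (t * y))
        (2 *\<^sub>R (LINT y|lborel. indicator {0..} y *\<^sub>R (g \<bar>y\<bar> * cos (t * y))))"
      using int by (intro has_bochner_integral_even_function has_bochner_integral_integrable)
        (use integrable_mult_indicator[OF _ int, of "{0..}"] in auto)
    moreover have "(LINT y|lborel. indicator {0..} y *\<^sub>R (g \<bar>y\<bar> * cos (t * y)))
        = (LINT y:{0..}|lborel. g y * cos (t * y))"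
      unfolding set_lebesgue_integral_def
      by (intro Bochner_Integration.integral_cong) (auto simp: indicator_def)
    ultimately show ?thesis
      using g by (auto simp: has_bochner_integral_iff classC_def)
  qed
qed simp

lemma classC_abs_le_1:
  assumes "g \<in> classC X" "0 \<le> x"
  shows "\<bar>g x\<bar> \<le> 1"
proof -
  \<comment> \<open>The two signs encode \<open>1 + cos\<close> and \<open>1 - cos\<close>, giving
    the lower and the upper bound.\<close>
  have "0 \<le> (\<Sum>i<2. [1, s] ! i * g \<bar>[0, x] ! i\<bar>)" if "s = 1 \<or> s = - 1" for s :: real
  proof (rule classC_cosine_polynomial[OF assms(1)])
    show "0 \<le> (\<Sum>i<2. [1, s] ! i * cos (t * [0, x] ! i))" for t
    proof -
      have "0 \<le> 1 + cos (t * x)"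
        using cos_ge_minus_one[of "t * x"] by linarith
      then show ?thesis using that by (auto simp: numeral_2_eq_2)
    qed
  qed
  from this[of 1] this[of "-1"] show ?thesis
    using assms by (auto simp: classC_def numeral_2_eq_2 abs_le_iff)
qed

text \<open>With 1 - cos z = 2 sin^2 (z/2), this is the subtraction formula for sine combined with
  (p - q)^2 \<le> 2 p^2 + 2 q^2.\<close>

lemma one_minus_cos_add_le:
  "1 - cos (a - b) \<le> 2 * (1 - cos a) + 2 * (1 - cos (b :: real))"
proof -
  have half: "1 - cos z = 2 * (sin (z / 2))\<^sup>2" for z :: real
    using cos_double_sin[of "z / 2"] by simp
  have "(sin ((a - b) / 2))\<^sup>2 = (sin (a / 2) * cos (b / 2) - cos (a / 2) * sin (b / 2))\<^sup>2"
    by (simp add: diff_divide_distrib sin_diff)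
  also have "\<dots> \<le> 2 * (sin (a / 2) * cos (b / 2))\<^sup>2 + 2 * (cos (a / 2) * sin (b / 2))\<^sup>2"
    using zero_le_power2[of "sin (a / 2) * cos (b / 2) + cos (a / 2) * sin (b / 2)"]
    by (simp add: power2_sum power2_diff)
  also have "\<dots> \<le> 2 * (sin (a / 2))\<^sup>2 + 2 * (sin (b / 2))\<^sup>2"
    by (intro add_mono mult_left_mono)
      (auto simp: power_mult_distrib abs_square_le_1 intro!: mult_left_le mult_left_le_one_le)
  finally show ?thesis unfolding half by simp
qed

lemma classC_one_minus_le:
  assumes g: "g \<in> classC X" and "0 \<le> x" "0 \<le> d"
  shows "1 - g d \<le> 2 * (1 - g (x + d)) + 2 * (1 - g x)"
proof -
  \<comment> \<open>The weights are those of \<open>one_minus_cos_add_le\<close> with all terms on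
    one side; the constant is 2 + 2 - 1 = 3.\<close>
  have "0 \<le> (\<Sum>i<4. [3, -2, -2, 1] ! i * g \<bar>[0, x + d, x, d] ! i\<bar>)"
  proof (rule classC_cosine_polynomial[OF g])
    show "0 \<le> (\<Sum>i<4. [3, -2, -2, 1] ! i * cos (t * [0, x + d, x, d] ! i))" for t
      using one_minus_cos_add_le[of "t * (x + d)" "t * x"]
      by (simp add: numeral_eq_Suc right_diff_distrib[symmetric])
  qed
  then show ?thesis
    using assms by (auto simp: classC_def numeral_eq_Suc)
qed

text \<open>The natural bound sqrt (2 (1 - cos (a - b))) is not linear in cosines, so it could not
  be transferred to \<open>g\<close>. The inequality of arithmetic and geometric means with
  parameter \<open>e\<close> replaces it by a linear one.\<close>

lemma abs_cos_diff_le: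
  fixes a b e :: real
  assumes "0 < e"
  shows "\<bar>cos a - cos b\<bar> \<le> e / 2 + (1 - cos (a - b)) / e"
proof -
  define q where "q = \<bar>sin ((a - b) / 2)\<bar>"
  have "cos a - cos b = 2 * sin ((a + b) / 2) * sin ((b - a) / 2)"
    by (rule cos_diff_cos)
  moreover have "\<bar>sin ((b - a) / 2)\<bar> = q"
    unfolding q_def by (metis abs_minus_cancel minus_diff_eq minus_divide_left sin_minus)
  ultimately have "\<bar>cos a - cos b\<bar> = 2 * \<bar>sin ((a + b) / 2)\<bar> * q"
    by (simp add: abs_mult)
  also have "\<dots> \<le> 2 * q"
    using mult_right_mono[OF abs_sin_le_one, of q "(a + b) / 2"] by (auto simp: q_def)
  also have "\<dots> \<le> e / 2 + 2 * q\<^sup>2 / e"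
  proof -
    have "2 * q * (2 * e) \<le> e * e + 4 * q\<^sup>2"
      using zero_le_power2[of "e - 2 * q"] by (simp add: power2_eq_square algebra_simps)
    then show ?thesis using assms by (simp add: field_simps power2_eq_square)
  qed
  also have "2 * q\<^sup>2 = 1 - cos (a - b)"
  proof -
    have "cos (a - b) = cos (2 * ((a - b) / 2))" by (rule arg_cong[where f = cos]) simp
    then show ?thesis by (simp only: cos_double_sin q_def power2_abs)
  qed
  finally show ?thesis .
qed

text \<open>A linearised form of |g x - g y|^2 \<le> 2 (1 - g |x - y|): continuity at 0 controls
  continuity everywhere. The sign \<open>s\<close> handles the two sides of the absolute
  value.\<close>

lemma classC_abs_diff_le:
  assumes g: "g \<in> classC X" and "0 \<le> x" "0 \<le> y" "0 < e"
  shows "\<bar>g x - g y\<bar> \<le> e / 2 + (1 - g \<bar>x - y\<bar>) / e"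
proof -
  have "0 \<le> (\<Sum>i<4. [e / 2 + 1 / e, - (1 / e), s, - s] ! i * g \<bar>[0, x - y, x, y] ! i\<bar>)"
    if "s = 1 \<or> s = - 1" for s :: real
  proof (rule classC_cosine_polynomial[OF g])
    show "0 \<le> (\<Sum>i<4. [e / 2 + 1 / e, - (1 / e), s, - s] ! i * cos (t * [0, x - y, x, y] ! i))" for t
      using that abs_cos_diff_le[OF \<open>0 < e\<close>, of "t * x" "t * y"]
      by (auto simp: numeral_eq_Suc right_diff_distrib diff_divide_distrib abs_le_iff)
  qed
  from this[of 1] this[of "-1"] show ?thesis
    using assms by (auto simp: classC_def numeral_eq_Suc abs_le_iff diff_divide_distrib)
qed

section \<open>The class is nonempty\<close>

text \<open>The transform is of Fejer type: the half-line integral is (1 - cos (t X)) / (t^2 X) for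
  nonzero \<open>t\<close>.\<close>

lemma triangle_in_classC:
  assumes "0 < X"
  shows "(\<lambda>x. max 0 (1 - x / X)) \<in> classC X"
proof -
  have eq: "(LINT x:{0..}|lborel. max 0 (1 - x / X) * cos (t * x))
      = (LINT x|lborel. indicator {0..X} x *\<^sub>R ((1 - x / X) * cos (t * x)))" for t
    unfolding set_lebesgue_integral_def
    using assms by (intro Bochner_Integration.integral_cong) (auto simp: indicator_def max_def field_simps)
  have "0 \<le> (LINT x|lborel. indicator {0..X} x *\<^sub>R ((1 - x / X) * cos (t * x)))" for t
  proof (cases "t = 0")
    case True
    then show ?thesis
      using assms by (auto intro!: Bochner_Integration.integral_nonneg simp: indicator_def field_simps)
  next
    case False
    \<comment> \<open>An antiderivative found by integration by parts.\<close>
    define F where "F x = (1 - x / X) * sin (t * x) / t - cos (t * x) / (t\<^sup>2 * X)" for x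
    have "(LINT x|lborel. indicator {0..X} x *\<^sub>R ((1 - x / X) * cos (t * x))) = F X - F 0"
    proof (rule integral_FTC_atLeastAtMost)
      show "(F has_vector_derivative (1 - x / X) * cos (t * x)) (at x within {0..X})" for x
        unfolding F_def has_real_derivative_iff_has_vector_derivative[symmetric]
        using False assms
        by (auto intro!: derivative_eq_intros simp: field_simps power2_eq_square)
    qed (use assms in \<open>auto intro!: continuous_intros\<close>)
    also have "\<dots> = (1 - cos (t * X)) / (t\<^sup>2 * X)"
      using assms by (simp add: F_def diff_divide_distrib)
    finally show ?thesis using assms by simp
  qed
  moreover have "max 0 (1 - x / X) = 0" if "X < x" for x
    using that assms by simp
  ultimately show ?thesis
    unfolding classC_def mem_Collect_eq eq using assms by (auto intro!: continuous_intros)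
qed

section \<open>The sinh integral and the modulus of continuity at 0\<close>

text \<open>Divergence is the value \<open>top\<close>, which makes \<open>lfun\<close> equal to
  minus infinity. On the class the integrand is nonnegative, so \<open>ennreal\<close> truncates
  nothing.\<close>

definition lfun_defect :: "(real \<Rightarrow> real) \<Rightarrow> ennreal" where
  "lfun_defect g = (\<integral>\<^sup>+ x. ennreal (indicator {0<..} x * ((1 - g x) / (2 * sinh (x / 2)))) \<partial>lborel)"

definition lfun_regular :: "int \<Rightarrow> (real \<Rightarrow> real) \<Rightarrow> real" where
  "lfun_regular D g =
     2 * (\<Sum>n. mangoldt n * real_of_int (kronecker D (int n)) / sqrt (real n) * g (ln (real n)))
     + ln (8 * pi * exp euler_mascheroni)
     + real_of_int (kronecker D (-1)) * (LINT x:{0..}|lborel. g x / (2 * cosh (x / 2)))"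

lemma lfun_eq: "lfun D g = ereal (lfun_regular D g) - enn2ereal (lfun_defect g)"
  by (simp add: lfun_def lfun_regular_def lfun_defect_def)

lemma measurable_defect_integrand:
  assumes "g \<in> classC X"
  shows "(\<lambda>x. indicator {0<..} x * ((1 - g x) / (2 * sinh (x / 2)))) \<in> borel_measurable borel"
proof -
  have "continuous_on {0<..} g"
    using assms by (auto simp: classC_def intro: continuous_on_subset)
  then have "continuous_on {0<..} (\<lambda>x. (1 - g x) / (2 * sinh (x / 2)))"
    by (intro continuous_intros) auto
  from borel_measurable_continuous_on_indicator[OF _ this] show ?thesis
    by simp
qed

text \<open>The range reaches 2 because the kernel is later evaluated at \<open>x\<close> and at
  \<open>d + x\<close> with \<open>x \<le> 1\<close> and \<open>d < 1\<close>.\<close>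

lemma sinh_half_le:
  fixes y :: real
  assumes "0 \<le> y" "y \<le> 2"
  shows "sinh (y / 2) \<le> y"
proof -
  have "exp (y / 2) \<le> 1 + y / 2 + (y / 2)\<^sup>2"
    using assms by (intro exp_bound) auto
  moreover have "1 - y / 2 \<le> exp (- (y / 2))"
    using exp_ge_add_one_self[of "- (y / 2)"] by simp
  moreover have "(y / 2)\<^sup>2 \<le> y / 2"
    using assms mult_left_mono[of y 2 y] by (simp add: power2_eq_square)
  ultimately show ?thesis
    using assms by (simp add: sinh_field_def)
qed

text \<open>The kernel is at least \<open>1 / (2 x)\<close> near \<open>0\<close>, whose integral over \<open>{d..1}\<close> diverges as
  \<open>d \<rightarrow> 0\<close>; and by positive definiteness \<open>1 - g\<close> cannot be small both at \<open>x\<close> and at \<open>x + d\<close>.\<close>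

lemma classC_modulus_at_0:
  assumes g: "g \<in> classC X" and A: "lfun_defect g \<le> ennreal A" "0 \<le> A" and d: "0 < d" "d < 1"
  shows "(1 - g d) * ln (1 / d) \<le> 16 * A"
proof -
  define f where "f x = indicator {0<..} x * ((1 - g x) / (2 * sinh (x / 2)))" for x
  have [measurable]: "f \<in> borel_measurable borel"
    unfolding f_def using g by (rule measurable_defect_integrand)
  have u: "0 \<le> 1 - g x" if "0 \<le> x" for x
    using classC_abs_le_1[OF g that] by linarith
  have f_ge: "(1 - g x) / (2 * x) \<le> f x" if "0 < x" "x \<le> 2" for x
    using that u[of x] sinh_half_le[of x] by (auto simp: f_def intro!: divide_left_mono)
  \<comment> \<open>Dividing by 8 leaves weights 1 / (4 x); as \<open>d \<le> x\<close>, the weight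
    1 / (4 x) is at most 1 / (2 (d + x)), the lower bound for the kernel at the shifted
    point.\<close>
  have pointwise: "(1 - g d) / 8 / x \<le> f x + f (d + x)" if x: "d \<le> x" "x \<le> 1" for x
  proof -
    have pos: "0 < x" using x d by simp
    have "(1 - g d) / 8 / x \<le> (2 * (1 - g (x + d)) + 2 * (1 - g x)) / 8 / x"
      using classC_one_minus_le[OF g, of x d] pos d by (intro divide_right_mono) auto
    also have "\<dots> = (1 - g x) / (4 * x) + (1 - g (d + x)) / (4 * x)"
      using pos by (simp add: field_simps)
    also have "\<dots> \<le> (1 - g x) / (2 * x) + (1 - g (d + x)) / (2 * (d + x))"
      using x d pos u[of x] u[of "d + x"] by (intro add_mono divide_left_mono mult_pos_pos) auto
    also have "\<dots> \<le> f x + f (d + x)"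
      using x d pos by (intro add_mono f_ge) auto
    finally show ?thesis .
  qed
  have f_nonneg: "0 \<le> f x" for x
    using u[of x] by (auto simp: f_def indicator_def)
  \<comment> \<open>Integrating over \<open>{d..1}\<close> produces the logarithm. By translation
    invariance both terms on the right contribute at most \<open>A\<close>, whence 16 = 8 *
    2.\<close>
  have "ennreal ((1 - g d) / 8 * ln 1 - (1 - g d) / 8 * ln d)
      = (\<integral>\<^sup>+ x. ennreal ((1 - g d) / 8 / x) * indicator {d..1} x \<partial>lborel)"
    using d u[of d]
    by (intro nn_integral_FTC_Icc[symmetric]) (auto intro!: derivative_eq_intros simp: field_simps)
  also have "\<dots> \<le> (\<integral>\<^sup>+ x. ennreal (f x) + ennreal (f (d + x)) \<partial>lborel)"
    using pointwise f_nonneg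
    by (intro nn_integral_mono) (auto simp: indicator_def ennreal_plus[symmetric] simp del: ennreal_plus intro!: ennreal_leI)
  also have "\<dots> = (\<integral>\<^sup>+ x. ennreal (f x) \<partial>lborel) + (\<integral>\<^sup>+ x. ennreal (f (d + x)) \<partial>lborel)"
    by (intro nn_integral_add) auto
  also have "(\<integral>\<^sup>+ x. ennreal (f (d + x)) \<partial>lborel) = (\<integral>\<^sup>+ x. ennreal (f x) \<partial>lborel)"
    using nn_integral_real_affine[of "\<lambda>x. ennreal (f x)" 1 d] by simp
  also have "(\<integral>\<^sup>+ x. ennreal (f x) \<partial>lborel) = lfun_defect g"
    by (simp add: lfun_defect_def f_def)
  also have "lfun_defect g + lfun_defect g \<le> ennreal A + ennreal A"
    using A by (intro add_mono)
  also have "\<dots> = ennreal (A + A)"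
    using A by (simp only: ennreal_plus)
  finally have "(1 - g d) / 8 * ln 1 - (1 - g d) / 8 * ln d \<le> A + A"
    using A by (subst (asm) ennreal_le_iff) auto
  then show ?thesis
    using d by (simp add: ln_div)
qed

section \<open>Compactness of the sublevel sets of the defect\<close>

lemma classC_equicontinuous:
  assumes "0 \<le> A" "0 < e"
  obtains \<delta> where "0 < \<delta>"
    "\<And>g x y. g \<in> classC X \<Longrightarrow> lfun_defect g \<le> ennreal A \<Longrightarrow> 0 \<le> x \<Longrightarrow> 0 \<le> y \<Longrightarrow> \<bar>x - y\<bar> < \<delta>
       \<Longrightarrow> \<bar>g x - g y\<bar> < e"
proof
  \<comment> \<open>Chosen so that \<open>e\<^sup>2 / 2 * L\<close> exceeds \<open>16 * A\<close>.
    The bound at 0 then forces \<open>1 - g d < e\<^sup>2 / 2\<close>, and both terms of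
    \<open>classC_abs_diff_le\<close> are at most \<open>e / 2\<close>, the second strictly
    less.\<close>
  define L where "L = 32 * A / e\<^sup>2 + 1"
  have L: "0 < L" using assms by (simp add: L_def add_nonneg_pos)
  show "0 < exp (- L)" by simp
  fix g x y
  assume g: "g \<in> classC X" "lfun_defect g \<le> ennreal A" and xy: "0 \<le> x" "0 \<le> y" "\<bar>x - y\<bar> < exp (- L)"
  show "\<bar>g x - g y\<bar> < e"
  proof (cases "x = y")
    case False
    define d where "d = \<bar>x - y\<bar>"
    have d: "0 < d" "d < exp (- L)" using False xy by (auto simp: d_def)
    then have d1: "d < 1"
      using L by (smt (verit) exp_le_one_iff)
    have "ln d < - L"
      using d by (metis exp_less_cancel_iff exp_ln)
    then have lnd: "L < ln (1 / d)" using d by (simp add: ln_div)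
    have "1 - g d < e\<^sup>2 / 2"
    proof (rule ccontr)
      assume "\<not> 1 - g d < e\<^sup>2 / 2"
      then have "e\<^sup>2 / 2 * L \<le> (1 - g d) * ln (1 / d)"
        using L lnd classC_abs_le_1[OF g(1), of d] d by (intro mult_mono) (auto simp: not_less intro: order_trans[of 0 "e\<^sup>2 / 2"])
      also have "\<dots> \<le> 16 * A"
        by (rule classC_modulus_at_0[OF g \<open>0 \<le> A\<close> d(1) d1])
      finally have "e\<^sup>2 / 2 * L \<le> 16 * A" .
      moreover have "e\<^sup>2 / 2 * L = 16 * A + e\<^sup>2 / 2"
        using assms by (simp add: L_def field_simps)
      ultimately show False using assms by (simp add: not_less[symmetric])
    qed
    then have "(1 - g d) / e < e / 2"
      using assms by (simp add: field_simps power2_eq_square)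
    moreover have "\<bar>g x - g y\<bar> \<le> e / 2 + (1 - g d) / e"
      unfolding d_def using g(1) xy(1,2) assms(2) by (rule classC_abs_diff_le)
    ultimately show ?thesis by linarith
  qed (use assms in simp)
qed

text \<open>Dominated convergence with majorant the indicator of \<open>{0..X}\<close>. The weight
  \<open>w\<close> will be a cosine, for closedness of the class, and half the hyperbolic secant,
  for the regular part.\<close>

lemma classC_set_integral_tendsto:
  assumes gs: "\<And>n. gs n \<in> classC X" and g: "\<And>x. 0 \<le> x \<Longrightarrow> (\<lambda>n. gs n x) \<longlonglongrightarrow> g x"
    and w: "continuous_on UNIV w" "\<And>x. \<bar>w x\<bar> \<le> 1"
  shows "(\<lambda>n. LINT x:{0..}|lborel. gs n x * w x) \<longlonglongrightarrow> (LINT x:{0..}|lborel. g x * w x)"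
  unfolding set_lebesgue_integral_def
proof (rule integral_dominated_convergence[where w = "indicat_real {0..X}"])
  have [measurable]: "(\<lambda>x. indicator {0..} x *\<^sub>R (gs n x * w x)) \<in> borel_measurable borel" for n
    using gs[of n] w
    by (intro borel_measurable_continuous_on_indicator continuous_on_mult) (auto simp: classC_def intro: continuous_on_subset)
  have lim: "(\<lambda>n. indicator {0..} x *\<^sub>R (gs n x * w x)) \<longlonglongrightarrow> indicator {0..} x *\<^sub>R (g x * w x)" for x
    using g[of x] by (cases "0 \<le> x") (auto intro!: tendsto_intros)
  show "(\<lambda>x. indicator {0..} x *\<^sub>R (g x * w x)) \<in> borel_measurable lborel"
    by (rule borel_measurable_LIMSEQ_real[OF lim]) measurable
  show "AE x in lborel. norm (indicator {0..} x *\<^sub>R (gs n x * w x)) \<le> indicat_real {0..X} x" for n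
  proof (rule AE_I2)
    fix x
    have "\<bar>gs n x\<bar> * \<bar>w x\<bar> \<le> 1 * 1" if "0 \<le> x"
      using classC_abs_le_1[OF gs that, of n] w(2)[of x] by (intro mult_mono) auto
    then show "norm (indicator {0..} x *\<^sub>R (gs n x * w x)) \<le> indicat_real {0..X} x"
      using gs[of n] by (auto simp: indicator_def classC_def abs_mult)
  qed
  show "AE x in lborel. (\<lambda>n. indicator {0..} x *\<^sub>R (gs n x * w x)) \<longlonglongrightarrow> indicator {0..} x *\<^sub>R (g x * w x)"
    using lim by auto
  show "(\<lambda>x. indicator {0..} x *\<^sub>R (gs n x * w x)) \<in> borel_measurable lborel" for n
    by measurable
  show "integrable lborel (indicat_real {0..X})"
    by (intro integrable_real_indicator) (auto simp: emeasure_lborel_Icc_eq)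
qed

lemma classC_sequentially_compact:
  assumes "0 < X" "0 \<le> A" and gs: "\<And>n. gs n \<in> classC X" "\<And>n. lfun_defect (gs n) \<le> ennreal A"
  obtains g r where "g \<in> classC X" "strict_mono (r :: nat \<Rightarrow> nat)"
    "\<And>x. 0 \<le> x \<Longrightarrow> (\<lambda>n. gs (r n) x) \<longlonglongrightarrow> g x"
proof -
  have "\<exists>d>0. \<forall>n y. y \<in> {0..X} \<and> norm (x - y) < d \<longrightarrow> norm (gs n x - gs n y) < e"
    if "x \<in> {0..X}" "0 < e" for x e
  proof -
    obtain d where "0 < d" "\<And>g x y. g \<in> classC X \<Longrightarrow> lfun_defect g \<le> ennreal A \<Longrightarrow> 0 \<le> x \<Longrightarrow> 0 \<le> y \<Longrightarrow>
        \<bar>x - y\<bar> < d \<Longrightarrow> \<bar>g x - g y\<bar> < e"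
      using classC_equicontinuous[OF \<open>0 \<le> A\<close> \<open>0 < e\<close>, of X] by blast
    then show ?thesis using that gs by (intro exI[of _ d]) auto
  qed
  moreover have "norm (gs n x) \<le> 1" if "x \<in> {0..X}" for n x
    using classC_abs_le_1[OF gs(1)] that by simp
  ultimately obtain h r where h: "continuous_on {0..X} h" and r: "strict_mono (r :: nat \<Rightarrow> nat)"
    and conv: "\<And>e. 0 < e \<Longrightarrow> \<exists>N. \<forall>n x. n \<ge> N \<and> x \<in> {0..X} \<longrightarrow> norm (gs (r n) x - h x) < e"
    using Arzela_Ascoli[of "{0..X}" gs 1] by (metis compact_Icc)
  have lim: "(\<lambda>n. gs (r n) x) \<longlonglongrightarrow> h x" if "x \<in> {0..X}" for x
    using conv that by (intro LIMSEQ_I) blast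
  \<comment> \<open>The class prescribes zeros only beyond \<open>X\<close>; the value at
    \<open>X\<close> itself follows by continuity from the right.\<close>
  have gsX: "gs n x = 0" if "X \<le> x" for n x
  proof (cases "x = X")
    case True
    have "continuous_on {0..} (gs n)" and zero: "\<And>y. X < y \<Longrightarrow> gs n y = 0"
      using gs by (auto simp: classC_def)
    then have "((gs n) \<longlongrightarrow> gs n X) (at X within {0..})"
      using \<open>0 < X\<close> by (auto simp: continuous_on_def)
    then have "((gs n) \<longlongrightarrow> gs n X) (at_right X)"
      by (rule tendsto_within_subset) (use \<open>0 < X\<close> in auto)
    moreover have "((gs n) \<longlongrightarrow> 0) (at_right X)"
      by (rule tendsto_eventually) (auto simp: eventually_at_filter zero)
    ultimately show ?thesis
      using True tendsto_unique trivial_limit_at_right_real by blast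
  qed (use gs that in \<open>auto simp: classC_def\<close>)
  have hX: "h X = 0"
    using lim[of X] \<open>0 < X\<close> by (simp add: gsX LIMSEQ_const_iff)
  \<comment> \<open>Continues \<open>h\<close> past \<open>X\<close> by its boundary value, which is
    0, so continuity and support hold together.\<close>
  define g where "g x = h (min x X)" for x
  have glim: "(\<lambda>n. gs (r n) x) \<longlonglongrightarrow> g x" if "0 \<le> x" for x
    using lim[of x] that by (cases "x \<le> X") (auto simp: g_def gsX hX min_def)
  have "g \<in> classC X"
    unfolding classC_def mem_Collect_eq
  proof (intro conjI allI impI)
    show "continuous_on {0..} g"
      unfolding g_def
      by (rule continuous_on_compose2[OF h]) (use \<open>0 < X\<close> in \<open>auto intro!: continuous_intros\<close>)
    show "g x = 0" if "X < x" for x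
      using that by (simp add: g_def hX)
    have "(\<lambda>n. gs (r n) 0) \<longlonglongrightarrow> 1"
      using gs by (simp add: classC_def)
    then show "g 0 = 1"
      using glim[of 0] LIMSEQ_unique by auto
    show "0 \<le> 2 * (LINT x:{0..}|lborel. g x * cos (t * x))" for t
    proof -
      have "(\<lambda>n. LINT x:{0..}|lborel. gs (r n) x * cos (t * x)) \<longlonglongrightarrow> (LINT x:{0..}|lborel. g x * cos (t * x))"
        by (rule classC_set_integral_tendsto[OF gs(1) glim]) (auto intro!: continuous_intros)
      then have "0 \<le> (LINT x:{0..}|lborel. g x * cos (t * x))"
        by (rule LIMSEQ_le_const) (use gs in \<open>auto simp: classC_def\<close>)
      then show ?thesis by simp
    qed
  qed
  with r glim show ?thesis using that by blast
qed

section \<open>Continuity and boundedness of the regular part, semicontinuity of the defect\<close>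

lemma lfun_regular_classC:
  assumes g: "g \<in> classC X"
  shows "lfun_regular D g =
     2 * (\<Sum>n\<in>{1..nat \<lfloor>exp X\<rfloor>}. mangoldt n * real_of_int (kronecker D (int n)) / sqrt (real n) * g (ln (real n)))
     + ln (8 * pi * exp euler_mascheroni)
     + real_of_int (kronecker D (-1)) * (LINT x:{0..}|lborel. g x * (1 / (2 * cosh (x / 2))))"
proof -
  \<comment> \<open>Index 0 is set apart: the support of \<open>g\<close> says nothing there, but
    division by \<open>sqrt 0\<close> makes the term 0.\<close>
  have "g (ln (real n)) = 0" if "n \<notin> {1..nat \<lfloor>exp X\<rfloor>}" "n \<noteq> 0" for n
  proof -
    have "nat \<lfloor>exp X\<rfloor> < n" using that by auto
    then have "exp X < real n" by linarith
    then have "X < ln (real n)" by (metis exp_gt_zero ln_exp ln_less_cancel_iff order_less_trans)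
    then show ?thesis using g by (simp add: classC_def)
  qed
  then have "(\<Sum>n. mangoldt n * real_of_int (kronecker D (int n)) / sqrt (real n) * g (ln (real n)))
     = (\<Sum>n\<in>{1..nat \<lfloor>exp X\<rfloor>}. mangoldt n * real_of_int (kronecker D (int n)) / sqrt (real n) * g (ln (real n)))"
    by (intro suminf_finite) (fastforce simp del: atLeastAtMost_iff)+
  then show ?thesis by (simp add: lfun_regular_def)
qed

lemma half_sech_bounded:
  fixes x :: real
  shows "\<bar>1 / (2 * cosh (x / 2))\<bar> \<le> 1"
proof -
  have "1 \<le> 2 * cosh (x / 2)"
    using cosh_real_ge_1[of "x / 2"] by linarith
  then have "1 / (2 * cosh (x / 2)) \<le> 1"
    by (subst divide_le_eq_1_pos) linarith+
  then show ?thesis by simp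
qed

lemma lfun_regular_tendsto:
  assumes gs: "\<And>n. gs n \<in> classC X" and g: "g \<in> classC X"
    and lim: "\<And>x. 0 \<le> x \<Longrightarrow> (\<lambda>n. gs n x) \<longlonglongrightarrow> g x"
  shows "(\<lambda>n. lfun_regular D (gs n)) \<longlonglongrightarrow> lfun_regular D g"
  unfolding lfun_regular_classC[OF gs] lfun_regular_classC[OF g]
  by (intro tendsto_intros lim classC_set_integral_tendsto[OF gs lim] half_sech_bounded
      continuous_on_divide continuous_on_cosh) (auto intro!: continuous_intros simp: ln_ge_zero_iff)

lemma lfun_regular_bounded_above:
  obtains M where "0 \<le> M" "\<And>g. g \<in> classC X \<Longrightarrow> lfun_regular D g \<le> M"
proof -
  let ?c = "\<lambda>n. mangoldt n * real_of_int (kronecker D (int n)) / sqrt (real n) :: real"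
  \<comment> \<open>Every value of \<open>g\<close> is replaced by 1 in absolute value;
    \<open>\<bar>X\<bar>\<close> bounds the length of the support for either sign of
    \<open>X\<close>.\<close>
  define M where "M = 2 * (\<Sum>n\<in>{1..nat \<lfloor>exp X\<rfloor>}. \<bar>?c n\<bar>) + \<bar>ln (8 * pi * exp euler_mascheroni)\<bar>
    + \<bar>real_of_int (kronecker D (-1))\<bar> * \<bar>X\<bar>"
  show ?thesis
  proof
    show "0 \<le> M"
      unfolding M_def by (intro add_nonneg_nonneg mult_nonneg_nonneg sum_nonneg) auto
    fix g assume g: "g \<in> classC X"
    have sum_le: "(\<Sum>n\<in>{1..nat \<lfloor>exp X\<rfloor>}. ?c n * g (ln (real n))) \<le> (\<Sum>n\<in>{1..nat \<lfloor>exp X\<rfloor>}. \<bar>?c n\<bar>)"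
    proof (rule sum_mono)
      fix n assume "n \<in> {1..nat \<lfloor>exp X\<rfloor>}"
      then have "\<bar>?c n * g (ln (real n))\<bar> \<le> \<bar>?c n\<bar>"
        unfolding abs_mult[of "?c n"] by (intro mult_left_le classC_abs_le_1[OF g]) auto
      then show "?c n * g (ln (real n)) \<le> \<bar>?c n\<bar>" by linarith
    qed
    have sech: "\<bar>LINT x:{0..}|lborel. g x * (1 / (2 * cosh (x / 2)))\<bar> \<le> \<bar>X\<bar>"
    proof -
      have "\<bar>LINT x:{0..}|lborel. g x * (1 / (2 * cosh (x / 2)))\<bar>
          \<le> (LINT x|lborel. \<bar>indicator {0..} x *\<^sub>R (g x * (1 / (2 * cosh (x / 2))))\<bar>)"
        unfolding set_lebesgue_integral_def by (rule integral_abs_bound)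
      also have "\<dots> \<le> (LINT x|lborel. indicat_real {0..\<bar>X\<bar>} x)"
      proof (rule integral_mono')
        fix x :: real
        have "\<bar>g x\<bar> * \<bar>1 / (2 * cosh (x / 2))\<bar> \<le> 1 * 1" if "0 \<le> x"
          using classC_abs_le_1[OF g that] half_sech_bounded[of x] by (intro mult_mono) auto
        then show "\<bar>indicator {0..} x *\<^sub>R (g x * (1 / (2 * cosh (x / 2))))\<bar> \<le> indicat_real {0..\<bar>X\<bar>} x"
          unfolding abs_mult[symmetric] using g by (auto simp: indicator_def classC_def)
      qed auto
      finally show ?thesis by simp
    qed
    have "real_of_int (kronecker D (-1)) * (LINT x:{0..}|lborel. g x * (1 / (2 * cosh (x / 2))))
        \<le> \<bar>real_of_int (kronecker D (-1))\<bar> * \<bar>X\<bar>"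
      using mult_left_mono[OF sech abs_ge_zero[of "real_of_int (kronecker D (-1))"]]
      unfolding abs_mult[symmetric] by linarith
    with sum_le show "lfun_regular D g \<le> M"
      unfolding lfun_regular_classC[OF g] M_def
      by (intro add_mono mult_left_mono) auto
  qed
qed

lemma lfun_defect_le_liminf:
  assumes gs: "\<And>n. gs n \<in> classC X" and lim: "\<And>x. 0 \<le> x \<Longrightarrow> (\<lambda>n. gs n x) \<longlonglongrightarrow> g x"
  shows "lfun_defect g \<le> liminf (\<lambda>n. lfun_defect (gs n))"
proof -
  let ?f = "\<lambda>g x. indicator {0<..} x * ((1 - g x) / (2 * sinh (x / 2))) :: real"
  have "(\<lambda>n. ?f (gs n) x) \<longlonglongrightarrow> ?f g x" for x
    using lim[of x] by (cases "0 < x") (auto intro!: tendsto_intros)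
  then have "liminf (\<lambda>n. ennreal (?f (gs n) x)) = ennreal (?f g x)" for x
    by (intro lim_imp_Liminf tendsto_ennrealI) auto
  then have "lfun_defect g = (\<integral>\<^sup>+ x. liminf (\<lambda>n. ennreal (?f (gs n) x)) \<partial>lborel)"
    by (simp add: lfun_defect_def)
  also have "\<dots> \<le> liminf (\<lambda>n. lfun_defect (gs n))"
    unfolding lfun_defect_def using measurable_defect_integrand[OF gs]
    by (intro nn_integral_liminf) simp
  finally show ?thesis .
qed

text \<open>The regular part is finite, so the splitting can be solved for the defect even when the
  latter is infinite. This turns limits of \<open>lfun\<close> into limits of the defect.\<close>

lemma lfun_defect_eq:
  "enn2ereal (lfun_defect g) = ereal (lfun_regular D g) - lfun D g"
  unfolding lfun_eq by (cases "lfun_defect g") (auto simp: enn2ereal_ennreal)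

theorem proposition2p1:
  fixes D :: int and X :: real
  assumes "fundamental_discriminant D" and "D \<noteq> 1" and "X > 0"
  shows "\<exists>gX \<in> classC X. \<forall>g \<in> classC X. lfun D gX \<ge> lfun D g"
proof -
  define S where "S = (SUP g\<in>classC X. lfun D g)"
  have upper: "lfun D g \<le> S" if "g \<in> classC X" for g
    using that by (auto simp: S_def intro: SUP_upper)
  show ?thesis
  proof (cases "S = -\<infinity>")
    case True
    then show ?thesis
      using triangle_in_classC[OF \<open>X > 0\<close>] upper by (auto intro!: bexI)
  next
    case False
    obtain M where M: "0 \<le> M" "\<And>g. g \<in> classC X \<Longrightarrow> lfun_regular D g \<le> M"
      using lfun_regular_bounded_above by blast
    have "lfun D g \<le> ereal M" if "g \<in> classC X" for g
      unfolding lfun_eq using M(2)[OF that]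
      by (cases "lfun_defect g") (auto simp: enn2ereal_ennreal)
    then have "S \<le> ereal M"
      unfolding S_def by (intro SUP_least)
    then have S_fin: "\<bar>S\<bar> \<noteq> \<infinity>" using False by auto
    obtain f where f: "incseq f" "range f \<subseteq> lfun D ` classC X" "S = (SUP i. f i)"
      using Sup_countable_SUP[of "lfun D ` classC X"] triangle_in_classC[OF \<open>X > 0\<close>]
      unfolding S_def by auto
    \<comment> \<open>Discarding the first \<open>k\<close> terms of the increasing sequence keeps
      all values above the finite number \<open>b\<close>.\<close>
    obtain k where k: "f k > -\<infinity>"
      using f(3) False by (metis SUP_bot_conv(2) bot_ereal_def ereal_infty_less_eq(2) not_less)
    define b where "b = real_of_ereal (f k)"
    have "f k \<le> S" using f(3) by (simp add: SUP_upper)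
    then have b: "f k = ereal b"
      using k S_fin by (cases "f k") (auto simp: b_def)
    have "\<exists>g\<in>classC X. f (i + k) = lfun D g" for i
      using f(2) by blast
    then obtain gs where gs: "\<And>i. gs i \<in> classC X" "\<And>i. f (i + k) = lfun D (gs i)"
      by metis
    have lim: "(\<lambda>i. lfun D (gs i)) \<longlonglongrightarrow> S"
      unfolding gs(2)[symmetric] f(3) using f(1) by (intro LIMSEQ_ignore_initial_segment LIMSEQ_SUP)
    \<comment> \<open>The defect is at most \<open>M - b\<close>; the absolute value keeps the bound
      nonnegative.\<close>
    have defect: "lfun_defect (gs i) \<le> ennreal (M + \<bar>b\<bar>)" for i
    proof -
      have "ereal b \<le> lfun D (gs i)"
        using f(1) b gs(2)[of i] by (metis incseqD le_add2)
      then show ?thesis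
        unfolding lfun_eq using M(2)[OF gs(1)[of i]]
        by (cases "lfun_defect (gs i)") (auto simp: enn2ereal_ennreal intro!: ennreal_leI)
    qed
    have Mb: "0 \<le> M + \<bar>b\<bar>" using M(1) by simp
    obtain g r where g: "g \<in> classC X" and r: "strict_mono (r :: nat \<Rightarrow> nat)"
      and glim: "\<And>x. 0 \<le> x \<Longrightarrow> (\<lambda>n. gs (r n) x) \<longlonglongrightarrow> g x"
      by (rule classC_sequentially_compact[of X "M + \<bar>b\<bar>" gs, OF \<open>X > 0\<close> Mb gs(1) defect]) blast
    \<comment> \<open>Both limits are finite, so subtraction is continuous here. The defects thus
      converge, and Fatou bounds the defect of \<open>g\<close> by their limit, which rearranges to
      \<open>S \<le> lfun D g\<close>.\<close>
    have "(\<lambda>n. ereal (lfun_regular D (gs (r n))) - lfun D (gs (r n))) \<longlonglongrightarrow> ereal (lfun_regular D g) - S"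
      using lfun_regular_tendsto[where gs = "\<lambda>n. gs (r n)", OF gs(1) g glim] LIMSEQ_subseq_LIMSEQ[OF lim r] S_fin
      by (intro tendsto_diff_ereal) (auto simp: o_def)
    then have *: "(\<lambda>n. enn2ereal (lfun_defect (gs (r n)))) \<longlonglongrightarrow> ereal (lfun_regular D g) - S"
      unfolding lfun_defect_eq[of _ D] .
    \<comment> \<open>Ensures that passing through \<open>e2ennreal\<close> loses nothing.\<close>
    then have nonneg: "0 \<le> ereal (lfun_regular D g) - S"
      by (rule LIMSEQ_le_const) auto
    have "lfun_defect g \<le> liminf (\<lambda>n. lfun_defect (gs (r n)))"
      by (rule lfun_defect_le_liminf[where gs = "\<lambda>n. gs (r n)", OF gs(1) glim])
    also have "\<dots> = e2ennreal (ereal (lfun_regular D g) - S)"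
      using tendsto_e2ennrealI[OF *] by (intro lim_imp_Liminf) auto
    finally have "enn2ereal (lfun_defect g) \<le> ereal (lfun_regular D g) - S"
      using nonneg by (metis enn2ereal_e2ennreal less_eq_ennreal.rep_eq)
    then have "S \<le> lfun D g"
      unfolding lfun_eq using S_fin by (cases S; cases "lfun_defect g") (auto simp: enn2ereal_ennreal)
    then show ?thesis
      using g upper by (intro bexI[of _ g]) (auto intro: order_trans)
  qed
qed

end
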